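(* Let $G_1$ and $G_2$ be looped simple graphs. The following are equivalent: (1) up to isomorphism, $G_2$ can be obtained from $G_1$ using edge pivots; (2) there is a compatible isomorphism $\beta:M(IAS(G_1))\to M(IAS(G_2))$ such that $f_\beta(v)\in\{1,(\phi\psi)\}$ for every looped $v\in V(G_1)$ and $f_\beta(v)\in\{1,(\phi\chi)\}$ for every unlooped $v\in V(G_1)$.
   Context: A looped simple graph is a finite graph in which each vertex may carry at most one loop and distinct non-loop edges join distinct pairs of vertices. The simple local complement $G^v_s$ complements all adjacencies between distinct neighbors of $v$. For neighbors $v\ne w$, the edge pivot is $G^{vw}=((G^v_s)^w_s)^v_s$; edge pivots are allowed on any edge, regardless of loops. $A(G)$ is the adjacency matrix over $GF(2)$ (diagonal $1$ iff looped). $M(IAS(G))$ is the binary matroid represented by the columns of $(I\mid A(G)\mid I+A(G))$; its ground set consists of columns $v_\phi,v_\chi,v_\psi$, the columns of $v$ in $I$, $A(G)$, $I+A(G)$. $S_3$ is the permutation group of $\{\phi,\chi,\psi\}$. A compatible isomorphism $\beta$ is a matroid isomorphism mapping each cell $\{v_\phi,v_\chi,v_\psi\}$ onto some cell; it induces a bijection $\beta:V(G_1)\to V(G_2)$ and $f_\beta:V(G_1)\to S_3$ with $\beta(v_\iota)=\beta(v)_{f_\beta(v)(\iota)}$. *)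

theory Defs
  imports Complex_Main "HOL-Library.Z2" "HOL-Library.Function_Algebras" "HOL-Combinatorics.Transposition"
begin

section \<open>Looped simple graphs and edge pivots\<close>

text \<open>
  An edge is the set of its endpoints, so a loop at \<open>v\<close> is the singleton \<open>{v}\<close>, and parallel
  edges and parallel loops are excluded by construction.
\<close>

record 'a lgraph =
  verts :: "'a set"
  edges :: "'a set set"

definition looped_simple_graph :: "'a lgraph \<Rightarrow> bool" where
  "looped_simple_graph G \<longleftrightarrow>
     finite (verts G) \<and> edges G \<subseteq> {{v, w} | v w. v \<in> verts G \<and> w \<in> verts G}"

definition looped :: "'a lgraph \<Rightarrow> 'a \<Rightarrow> bool" where
  "looped G v \<longleftrightarrow> {v} \<in> edges G"

text \<open>Neighbors are taken in the open sense: a looped vertex is not a neighbor of itself.\<close>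

definition neighbors :: "'a lgraph \<Rightarrow> 'a \<Rightarrow> 'a set" where
  "neighbors G v = {w \<in> verts G. w \<noteq> v \<and> {v, w} \<in> edges G}"

definition local_complement :: "'a lgraph \<Rightarrow> 'a \<Rightarrow> 'a lgraph" where
  "local_complement G v =
     (let N = {{x, y} | x y. x \<in> neighbors G v \<and> y \<in> neighbors G v \<and> x \<noteq> y}
      in G\<lparr>edges := (edges G - N) \<union> (N - edges G)\<rparr>)"

definition edge_pivot :: "'a lgraph \<Rightarrow> 'a \<Rightarrow> 'a \<Rightarrow> 'a lgraph" where
  "edge_pivot G v w = local_complement (local_complement (local_complement G v) w) v"

definition pivot_step :: "'a lgraph \<Rightarrow> 'a lgraph \<Rightarrow> bool" where
  "pivot_step G H \<longleftrightarrow> (\<exists>v \<in> verts G. \<exists>w \<in> neighbors G v. H = edge_pivot G v w)"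

text \<open>The case \<open>x = y\<close> makes an isomorphism preserve loops.\<close>

definition graph_iso :: "('a \<Rightarrow> 'b) \<Rightarrow> 'a lgraph \<Rightarrow> 'b lgraph \<Rightarrow> bool" where
  "graph_iso h G H \<longleftrightarrow> bij_betw h (verts G) (verts H) \<and>
     (\<forall>x \<in> verts G. \<forall>y \<in> verts G. {x, y} \<in> edges G \<longleftrightarrow> {h x, h y} \<in> edges H)"

definition graph_isomorphic :: "'a lgraph \<Rightarrow> 'b lgraph \<Rightarrow> bool" where
  "graph_isomorphic G H \<longleftrightarrow> (\<exists>h. graph_iso h G H)"

lemma looped_simple_graph_local_complement:
  assumes "looped_simple_graph G"
  shows "looped_simple_graph (local_complement G v)"
  using assms unfolding looped_simple_graph_def local_complement_def neighbors_def Let_def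
  by auto

lemma looped_local_complement [simp]: "looped (local_complement G v) u \<longleftrightarrow> looped G u"
proof -
  have "{u} = {x, y} \<longleftrightarrow> x = u \<and> y = u" for x y by auto
  then show ?thesis unfolding looped_def local_complement_def Let_def by auto
qed


section \<open>Matroids\<close>

record 'e matroid =
  ground :: "'e set"
  indep :: "'e set \<Rightarrow> bool"

definition is_matroid :: "'e matroid \<Rightarrow> bool" where
  "is_matroid M \<longleftrightarrow>
     finite (ground M) \<and>
     (\<forall>S. indep M S \<longrightarrow> S \<subseteq> ground M) \<and>
     indep M {} \<and>
     (\<forall>S T. indep M T \<and> S \<subseteq> T \<longrightarrow> indep M S) \<and>
     (\<forall>S T. indep M S \<and> indep M T \<and> card S < card T \<longrightarrow>
        (\<exists>t \<in> T - S. indep M (insert t S)))"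

definition matroid_iso :: "('e \<Rightarrow> 'f) \<Rightarrow> 'e matroid \<Rightarrow> 'f matroid \<Rightarrow> bool" where
  "matroid_iso \<beta> M N \<longleftrightarrow> bij_betw \<beta> (ground M) (ground N) \<and>
     (\<forall>S \<subseteq> ground M. indep M S \<longleftrightarrow> indep N (\<beta> ` S))"

text \<open>
  The columns of \<open>A\<close> (rows \<open>R\<close>, columns \<open>E\<close>) are treated as a family indexed by \<open>E\<close>, not as a
  set of vectors: two equal columns with different indices are dependent.
\<close>

definition column_matroid :: "'r set \<Rightarrow> 'e set \<Rightarrow> ('r \<Rightarrow> 'e \<Rightarrow> 'k::field) \<Rightarrow> 'e matroid" where
  "column_matroid R E A =
     \<lparr>ground = E,
      indep = (\<lambda>S. S \<subseteq> E \<and>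
        (\<forall>c. (\<forall>r \<in> R. (\<Sum>e \<in> S. c e * A r e) = 0) \<longrightarrow> (\<forall>e \<in> S. c e = 0)))\<rparr>"

lemma ground_column_matroid [simp]: "ground (column_matroid R E A) = E"
  by (simp add: column_matroid_def)

lemma vector_space_fun: "vector_space (\<lambda>(c::'k::field) f. (\<lambda>r::'r. c * f r))"
  by unfold_locales (auto simp: algebra_simps)

text \<open>Agreement with the library's linear independence of sets of vectors.\<close>

lemma indep_column_matroid_iff:
  fixes R :: "'r set" and A :: "'r \<Rightarrow> 'e \<Rightarrow> 'k::field"
  defines "col \<equiv> \<lambda>e r. if r \<in> R then A r e else 0"
  assumes "finite E"
  shows "indep (column_matroid R E A) S \<longleftrightarrow>
    S \<subseteq> E \<and> inj_on col S \<and> \<not> module.dependent (\<lambda>c f r. c * f r) (col ` S)"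
proof (cases "S \<subseteq> E")
  case True
  interpret vector_space "\<lambda>(c::'k) f. (\<lambda>r::'r. c * f r)" by (rule vector_space_fun)
  have fin: "finite S" using True assms(2) finite_subset by blast
  have apply_sum: "(\<Sum>e\<in>T. F e) r = (\<Sum>e\<in>T. F e r)" for F :: "'x \<Rightarrow> 'r \<Rightarrow> 'k" and T r
    by (induction T rule: infinite_finite_induct) auto
  have zero_iff: "(\<forall>r\<in>R. (\<Sum>e\<in>S. c e * A r e) = 0) \<longleftrightarrow> (\<Sum>e\<in>S. (\<lambda>r. c e * col e r)) = 0" for c
  proof -
    have "(\<Sum>e\<in>S. c e * col e r) = (if r \<in> R then \<Sum>e\<in>S. c e * A r e else 0)" for r
      by (simp add: col_def)
    then show ?thesis by (auto simp: fun_eq_iff apply_sum)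
  qed
  have ind: "indep (column_matroid R E A) S \<longleftrightarrow>
      (\<forall>c. (\<Sum>e\<in>S. (\<lambda>r. c e * col e r)) = 0 \<longrightarrow> (\<forall>e\<in>S. c e = 0))"
    using True by (simp add: column_matroid_def zero_iff)
  show ?thesis
  proof
    assume I: "indep (column_matroid R E A) S"
    have inj: "inj_on col S"
    proof (rule inj_onI, rule ccontr)
      fix x y assume xy: "x \<in> S" "y \<in> S" "col x = col y" "x \<noteq> y"
      define c :: "'e \<Rightarrow> 'k" where "c = (\<lambda>e. if e = x then 1 else if e = y then -1 else 0)"
      have "(\<Sum>e\<in>S. c e * col e r) = 0" for r
      proof -
        have "(\<Sum>e\<in>S. c e * col e r) = (\<Sum>e\<in>{x,y}. c e * col e r)"
          by (rule sum.mono_neutral_right) (use fin xy in \<open>auto simp: c_def\<close>)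
        also have "\<dots> = 0" using xy by (simp add: c_def)
        finally show ?thesis .
      qed
      then have "(\<Sum>e\<in>S. (\<lambda>r. c e * col e r)) = 0" by (simp add: fun_eq_iff apply_sum)
      then have "c x = 0" using I[unfolded ind, rule_format, of c x] xy(1) by blast
      then show False by (simp add: c_def)
    qed
    have "independent (col ` S)"
    proof (rule independent_if_scalars_zero)
      show "finite (col ` S)" using fin by simp
      fix f x assume "(\<Sum>x\<in>col ` S. (\<lambda>r. f x * x r)) = 0" and x: "x \<in> col ` S"
      then have "(\<Sum>e\<in>S. (\<lambda>r. f (col e) * col e r)) = 0"
        by (simp add: sum.reindex[OF inj])
      then have "\<forall>e\<in>S. f (col e) = 0"
        using I[unfolded ind, THEN spec, of "\<lambda>e. f (col e)"] by simp
      then show "f x = 0" using x by blast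
    qed
    then show "S \<subseteq> E \<and> inj_on col S \<and> independent (col ` S)" using True inj by blast
  next
    assume *: "S \<subseteq> E \<and> inj_on col S \<and> independent (col ` S)"
    show "indep (column_matroid R E A) S" unfolding ind
    proof (intro allI impI ballI)
      fix c e assume c: "(\<Sum>e\<in>S. (\<lambda>r. c e * col e r)) = 0" and e: "e \<in> S"
      define u where "u = c \<circ> inv_into S col"
      have u: "u (col e) = c e" if "e \<in> S" for e using * that by (simp add: u_def)
      have "(\<Sum>x\<in>col ` S. (\<lambda>r. u x * x r)) = 0"
        using * c by (simp add: sum.reindex u)
      then have "u (col e) = 0"
        using independentD[of "col ` S" "col ` S" u "col e"] * fin e by simp
      then show "c e = 0" using u e by simp
    qed
  qed
qed (simp add: column_matroid_def)

lemma is_matroid_column_matroid: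
  assumes "finite E"
  shows "is_matroid (column_matroid R E (A :: 'r \<Rightarrow> 'e \<Rightarrow> 'k::field))"
proof -
  interpret vector_space "\<lambda>(c::'k) f. (\<lambda>r::'r. c * f r)" by (rule vector_space_fun)
  define col where "col = (\<lambda>e r. if r \<in> R then A r e else 0)"
  have ind: "indep (column_matroid R E A) S \<longleftrightarrow> S \<subseteq> E \<and> inj_on col S \<and> independent (col ` S)" for S
    unfolding indep_column_matroid_iff[OF assms] col_def ..
  have aug: "\<exists>t\<in>T - S. indep (column_matroid R E A) (insert t S)"
    if S: "indep (column_matroid R E A) S" and T: "indep (column_matroid R E A) T"
      and less: "card S < card T" for S T
  proof -
    have "\<not> col ` T \<subseteq> span (col ` S)"
    proof
      assume "col ` T \<subseteq> span (col ` S)"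
      moreover have "finite (col ` S)" using S assms by (auto simp: ind intro: finite_subset)
      ultimately have "card (col ` T) \<le> card (col ` S)"
        using independent_span_bound[of "col ` S" "col ` T"] T by (simp add: ind)
      then show False using S T less by (simp add: ind card_image)
    qed
    then obtain t where t: "t \<in> T" "col t \<notin> span (col ` S)" by blast
    then have "col t \<notin> col ` S" using span_base by blast
    then have "t \<notin> S" "inj_on col (insert t S)" "independent (col ` insert t S)"
      using S t(2) by (auto simp: ind independent_insertI)
    then show ?thesis using S T t unfolding ind by blast
  qed
  have empty: "indep (column_matroid R E A) {}" unfolding ind by (simp add: independent_empty)
  have sub: "indep (column_matroid R E A) S"
    if "indep (column_matroid R E A) T" "S \<subseteq> T" for S T
  proof -
    have "independent (col ` S)"
      by (rule independent_mono[of "col ` T"]) (use that in \<open>auto simp: ind\<close>)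
    then show ?thesis using that inj_on_subset[of col T S] by (auto simp: ind)
  qed
  have ground: "S \<subseteq> E" if "indep (column_matroid R E A) S" for S
    using that by (simp add: ind)
  show ?thesis
    unfolding is_matroid_def ground_column_matroid
    by (intro conjI allI impI; (elim conjE)?) (fact assms, erule ground, fact empty, erule (1) sub, erule (2) aug)
qed


section \<open>Isotropic matroids and compatible isomorphisms\<close>

datatype label = Phi | Chi | Psi

definition adjacency_matrix :: "'a lgraph \<Rightarrow> 'a \<Rightarrow> 'a \<Rightarrow> bit" where
  "adjacency_matrix G v w = of_bool ({v, w} \<in> edges G)"

fun IAS :: "'a lgraph \<Rightarrow> 'a \<Rightarrow> 'a \<times> label \<Rightarrow> bit" where
  "IAS G r (v, Phi) = of_bool (r = v)"
| "IAS G r (v, Chi) = adjacency_matrix G r v"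
| "IAS G r (v, Psi) = of_bool (r = v) + adjacency_matrix G r v"

definition isotropic_matroid :: "'a lgraph \<Rightarrow> ('a \<times> label) matroid" where
  "isotropic_matroid G = column_matroid (verts G) (verts G \<times> UNIV) (IAS G)"

definition cell :: "'a \<Rightarrow> ('a \<times> label) set" where
  "cell v = {(v, Phi), (v, Chi), (v, Psi)}"

definition compatible_iso ::
  "('a \<times> label \<Rightarrow> 'b \<times> label) \<Rightarrow> 'a lgraph \<Rightarrow> 'b lgraph \<Rightarrow> bool" where
  "compatible_iso \<beta> G H \<longleftrightarrow>
     matroid_iso \<beta> (isotropic_matroid G) (isotropic_matroid H) \<and>
     (\<forall>v \<in> verts G. \<exists>w \<in> verts H. \<beta> ` cell v = cell w)"

text \<open>
  The induced vertex map and the induced label maps \<open>f\<^sub>\<beta>\<close>. They are meaningful only for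
  compatible \<open>\<beta>\<close>; the choice of \<open>Phi\<close> in the former is then immaterial.
\<close>

definition vertex_map :: "('a \<times> label \<Rightarrow> 'b \<times> label) \<Rightarrow> 'a \<Rightarrow> 'b" where
  "vertex_map \<beta> v = fst (\<beta> (v, Phi))"

definition label_map :: "('a \<times> label \<Rightarrow> 'b \<times> label) \<Rightarrow> 'a \<Rightarrow> label \<Rightarrow> label" where
  "label_map \<beta> v \<iota> = snd (\<beta> (v, \<iota>))"

lemma UNIV_label: "(UNIV :: label set) = {Phi, Chi, Psi}"
  using label.exhaust by auto

lemma cell_altdef: "cell v = {v} \<times> UNIV"
  by (auto simp: cell_def UNIV_label)

lemma is_matroid_isotropic_matroid:
  "looped_simple_graph G \<Longrightarrow> is_matroid (isotropic_matroid G)"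
  unfolding isotropic_matroid_def looped_simple_graph_def
  by (intro is_matroid_column_matroid) (simp add: UNIV_label)

lemma compatible_iso_apply:
  assumes "compatible_iso \<beta> G H" "v \<in> verts G"
  shows "\<beta> (v, \<iota>) = (vertex_map \<beta> v, label_map \<beta> v \<iota>)"
proof -
  obtain w where w: "\<beta> ` cell v = cell w" using assms unfolding compatible_iso_def by blast
  have "\<beta> (v, \<kappa>) \<in> cell w" for \<kappa> unfolding w[symmetric] by (rule imageI) (simp add: cell_altdef)
  then have "fst (\<beta> (v, \<kappa>)) = w" for \<kappa> by (simp add: cell_altdef mem_Times_iff)
  then show ?thesis by (simp add: vertex_map_def label_map_def prod_eq_iff)
qed

lemma bij_label_map:
  assumes "compatible_iso \<beta> G H" "v \<in> verts G"
  shows "bij (label_map \<beta> v)"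
proof -
  have inj: "inj_on \<beta> (verts G \<times> UNIV)"
    using assms(1)
    by (simp add: compatible_iso_def matroid_iso_def isotropic_matroid_def bij_betw_def)
  have "inj (label_map \<beta> v)"
  proof (rule injI)
    fix \<iota> \<kappa> assume "label_map \<beta> v \<iota> = label_map \<beta> v \<kappa>"
    then have "\<beta> (v, \<iota>) = \<beta> (v, \<kappa>)" by (simp add: compatible_iso_apply[OF assms])
    then show "\<iota> = \<kappa>" using inj_onD[OF inj] assms(2) by blast
  qed
  moreover have "finite (UNIV :: label set)" by (simp add: UNIV_label)
  ultimately show ?thesis using finite_UNIV_inj_surj by (auto simp: bij_def)
qed

lemma bij_betw_vertex_map:
  assumes "compatible_iso \<beta> G H"
  shows "bij_betw (vertex_map \<beta>) (verts G) (verts H)"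
proof -
  have bij: "bij_betw \<beta> (verts G \<times> UNIV) (verts H \<times> UNIV)"
    using assms by (simp add: compatible_iso_def matroid_iso_def isotropic_matroid_def)
  have "inj_on (vertex_map \<beta>) (verts G)"
  proof (rule inj_onI)
    fix v w assume vw: "v \<in> verts G" "w \<in> verts G" "vertex_map \<beta> v = vertex_map \<beta> w"
    obtain \<kappa> where "label_map \<beta> w \<kappa> = label_map \<beta> v Phi"
      using bij_label_map[OF assms vw(2)] by (metis bij_pointE)
    then have "\<beta> (v, Phi) = \<beta> (w, \<kappa>)" using vw by (simp add: compatible_iso_apply[OF assms])
    then show "v = w" using inj_onD[OF bij_betw_imp_inj_on[OF bij]] vw by blast
  qed
  moreover have "vertex_map \<beta> ` verts G = verts H"
  proof -
    have "verts H = fst ` \<beta> ` (verts G \<times> UNIV)" using bij_betw_imp_surj_on[OF bij] by force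
    also have "\<dots> = vertex_map \<beta> ` verts G"
      by (force simp: compatible_iso_apply[OF assms] image_iff)
    finally show ?thesis ..
  qed
  ultimately show ?thesis by (simp add: bij_betw_def)
qed

end

theory Submission imports Defs begin

text \<open>
  Call the column of \<open>v\<close> with zero diagonal entry the simple column: it is \<open>v\<^sub>\<chi>\<close> for unlooped and
  \<open>v\<^sub>\<psi>\<close> for looped \<open>v\<close>. The permitted label maps either fix all labels or exchange \<open>v\<^sub>\<phi>\<close> with the
  simple column. A pivot on \<open>vw\<close> is a row reduction of \<open>(I | A | I + A)\<close> after exchanging these
  columns at \<open>v\<close> and \<open>w\<close>, so it induces a compatible isomorphism of the permitted kind.

  Conversely, let \<open>S\<close> be the set of vertices with nontrivial label map. The simple columns of \<open>S\<close>
  and the \<open>\<phi>\<close>-columns outside \<open>S\<close> form a basis, being mapped to the \<open>\<phi>\<close>-columns of \<open>G2\<close>. If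
  \<open>v \<in> S\<close> had no neighbor in \<open>S\<close>, its simple column would be a sum of \<open>\<phi>\<close>-columns outside \<open>S\<close>.
  So \<open>S\<close> contains an edge \<open>vw\<close>, and pivoting on it removes \<open>v\<close> and \<open>w\<close> from \<open>S\<close>. Once \<open>S\<close> is
  empty, the vertex map is a graph isomorphism.
\<close>

section \<open>Isomorphisms of matroids and of column matroids\<close>

lemma matroid_iso_comp:
  assumes "matroid_iso f L M" "matroid_iso g M N"
  shows "matroid_iso (g \<circ> f) L N"
proof -
  have bij: "bij_betw f (ground L) (ground M)" "bij_betw g (ground M) (ground N)"
    using assms by (simp_all add: matroid_iso_def)
  have "indep L S \<longleftrightarrow> indep N ((g \<circ> f) ` S)" if "S \<subseteq> ground L" for S
  proof -
    have "f ` S \<subseteq> ground M" using that bij by (auto simp: bij_betw_def)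
    then show ?thesis using assms that by (simp add: matroid_iso_def image_comp)
  qed
  then show ?thesis using bij_betw_trans[OF bij] by (simp add: matroid_iso_def)
qed

lemma matroid_iso_involution:
  assumes "matroid_iso f M N" and inv: "\<And>x. f (f x) = x"
  shows "matroid_iso f N M"
proof -
  have bij: "bij_betw f (ground M) (ground N)" using assms(1) by (simp add: matroid_iso_def)
  have "bij_betw f (ground N) (ground M)"
  proof (rule bij_betw_byWitness[where f' = f])
    show "f ` ground N \<subseteq> ground M" "f ` ground M \<subseteq> ground N"
      using bij_betw_imp_surj_on[OF bij, symmetric] by (auto simp: inv)
  qed (simp_all add: inv)
  moreover have "indep N S \<longleftrightarrow> indep M (f ` S)" if "S \<subseteq> ground N" for S
  proof -
    have "f ` S \<subseteq> ground M" using that calculation by (auto simp: bij_betw_def)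
    moreover have "f ` f ` S = S" by (simp add: image_image inv)
    ultimately show ?thesis using assms(1) by (simp add: matroid_iso_def)
  qed
  ultimately show ?thesis by (simp add: matroid_iso_def)
qed

text \<open>Independence depends only on which coefficient families annihilate every row. As
  \<open>f\<close> is injective, the families for both matrices can be indexed by the same
  \<open>S\<close>, so row operations and renamings of rows are easily seen to satisfy
  \<open>rows\<close>.\<close>

lemma matroid_iso_column_matroidI:
  fixes A :: "'r \<Rightarrow> 'e \<Rightarrow> 'k::field" and B :: "'s \<Rightarrow> 'f \<Rightarrow> 'k"
  assumes bij: "bij_betw f E F"
    and rows: "\<And>c S. S \<subseteq> E \<Longrightarrow>
      (\<forall>r\<in>Q. (\<Sum>e\<in>S. c e * A r e) = 0) \<longleftrightarrow> (\<forall>r\<in>R. (\<Sum>e\<in>S. c e * B r (f e)) = 0)"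
  shows "matroid_iso f (column_matroid Q E A) (column_matroid R F B)"
proof -
  have "indep (column_matroid Q E A) S \<longleftrightarrow> indep (column_matroid R F B) (f ` S)"
    if S: "S \<subseteq> E" for S
  proof -
    have inj: "inj_on f S" using bij S by (auto simp: bij_betw_def intro: inj_on_subset)
    have sub: "f ` S \<subseteq> F" using bij S by (auto simp: bij_betw_def)
    have B: "indep (column_matroid R F B) (f ` S) \<longleftrightarrow>
      (\<forall>d. (\<forall>r\<in>R. (\<Sum>e\<in>S. d (f e) * B r (f e)) = 0) \<longrightarrow> (\<forall>e\<in>S. d (f e) = 0))"
      using sub by (simp add: column_matroid_def sum.reindex[OF inj])
    have A: "indep (column_matroid Q E A) S \<longleftrightarrow>
      (\<forall>c. (\<forall>r\<in>R. (\<Sum>e\<in>S. c e * B r (f e)) = 0) \<longrightarrow> (\<forall>e\<in>S. c e = 0))"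
      using S by (simp add: column_matroid_def rows)
    show ?thesis
    proof
      assume "indep (column_matroid Q E A) S"
      then show "indep (column_matroid R F B) (f ` S)"
        unfolding A B by (auto dest: spec[where x = "_ \<circ> f"])
    next
      assume *: "indep (column_matroid R F B) (f ` S)"
      show "indep (column_matroid Q E A) S" unfolding A
      proof (intro allI impI)
        fix c assume c: "\<forall>r\<in>R. (\<Sum>e\<in>S. c e * B r (f e)) = 0"
        \<comment> \<open>Independence of the image concerns coefficients of image columns, so
          \<open>c\<close> is carried over along the inverse of \<open>f\<close> on
          \<open>S\<close>.\<close>
        have eq: "(c \<circ> inv_into S f) (f e) = c e" if "e \<in> S" for e
          using that inj by simp
        then have "\<forall>r\<in>R. (\<Sum>e\<in>S. (c \<circ> inv_into S f) (f e) * B r (f e)) = 0"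
          using c by (simp cong: sum.cong)
        then have "\<forall>e\<in>S. (c \<circ> inv_into S f) (f e) = 0" using * unfolding B by blast
        then show "\<forall>e\<in>S. c e = 0" using eq by simp
      qed
    qed
  qed
  then show ?thesis using bij by (simp add: matroid_iso_def)
qed

section \<open>Compatible isomorphisms and permitted label maps\<close>

lemma compatible_iso_comp:
  assumes "compatible_iso f F G" "compatible_iso g G H"
  shows "compatible_iso (g \<circ> f) F H"
  using assms matroid_iso_comp[of f _ _ g]
  unfolding compatible_iso_def by (metis image_comp)

text \<open>\<open>loop_swap G v Phi\<close> is the label of the simple column of \<open>v\<close>.
  Only loops enter, so pivots do not affect it.\<close>

definition loop_swap :: "'a lgraph \<Rightarrow> 'a \<Rightarrow> label \<Rightarrow> label" where
  "loop_swap G v = (if looped G v then transpose Phi Psi else transpose Phi Chi)"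

lemma loop_swap_involutory: "loop_swap G v (loop_swap G v i) = i"
  by (simp add: loop_swap_def)

definition simple_iso :: "('a \<times> label \<Rightarrow> 'b \<times> label) \<Rightarrow> 'a lgraph \<Rightarrow> 'b lgraph \<Rightarrow> bool" where
  "simple_iso f G H \<longleftrightarrow> compatible_iso f G H \<and>
     (\<forall>v\<in>verts G. label_map f v \<in> {id, loop_swap G v})"

definition pivot_map :: "'a lgraph \<Rightarrow> 'a \<Rightarrow> 'a \<Rightarrow> 'a \<times> label \<Rightarrow> 'a \<times> label" where
  "pivot_map G v w = (\<lambda>(u, i). (u, if u = v \<or> u = w then loop_swap G u i else i))"

lemma pivot_map_involutory: "pivot_map G v w (pivot_map G v w e) = e"
  by (cases e) (simp add: pivot_map_def loop_swap_involutory)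

section \<open>Pivots and the isotropic matroid\<close>

lemma verts_local_complement [simp]: "verts (local_complement G v) = verts G"
  by (simp add: local_complement_def Let_def)

lemma edge_local_complement:
  "{x, y} \<in> edges (local_complement G v) \<longleftrightarrow>
    ({x, y} \<in> edges G) \<noteq> (x \<noteq> y \<and> x \<in> neighbors G v \<and> y \<in> neighbors G v)"
  unfolding local_complement_def Let_def by (auto simp: doubleton_eq_iff)

lemma verts_edge_pivot [simp]: "verts (edge_pivot G v w) = verts G"
  by (simp add: edge_pivot_def)

lemma looped_edge_pivot [simp]: "looped (edge_pivot G v w) u \<longleftrightarrow> looped G u"
  by (simp add: edge_pivot_def)

lemma loop_swap_edge_pivot [simp]: "loop_swap (edge_pivot G v w) u = loop_swap G u"
  by (simp add: loop_swap_def)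

text \<open>The three local complementations exchange the other neighbors of \<open>v\<close> and
  \<open>w\<close>. A pair \<open>x\<close>, \<open>y\<close> apart from them is toggled iff the 2
  by 2 minor of the adjacency matrix with rows \<open>x\<close>, \<open>y\<close> and columns
  \<open>v\<close>, \<open>w\<close> is nonzero. The disjuncts \<open>y = w\<close> and
  \<open>y = v\<close> keep the edge \<open>vw\<close> itself, where the second disjunct would ask
  for a loop.\<close>

lemma edge_edge_pivot:
  assumes v: "v \<in> verts G" and w: "w \<in> neighbors G v" and x: "x \<in> verts G" and y: "y \<in> verts G"
  shows "{x, y} \<in> edges (edge_pivot G v w) \<longleftrightarrow>
    (if x = y then {x, x} \<in> edges G
     else if x = v then y = w \<or> {w, y} \<in> edges G
     else if x = w then y = v \<or> {v, y} \<in> edges G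
     else if y = v then {w, x} \<in> edges G
     else if y = w then {v, x} \<in> edges G
     else (({x, y} \<in> edges G) \<noteq> ({v, x} \<in> edges G \<and> {w, y} \<in> edges G))
          \<noteq> ({w, x} \<in> edges G \<and> {v, y} \<in> edges G))"
proof -
  have vw: "v \<noteq> w" "w \<in> verts G" "{v, w} \<in> edges G" "{w, v} \<in> edges G"
    using w by (auto simp: neighbors_def insert_commute)
  have c: "{x, v} = {v, x}" "{x, w} = {w, x}" "{y, v} = {v, y}" "{y, w} = {w, y}" "{y, x} = {x, y}"
    by auto
  show ?thesis
  proof (cases "x = y")
    case True
    then show ?thesis using looped_edge_pivot[of G v w y] by (simp add: looped_def)
  next
    case False
    then show ?thesis
      unfolding edge_pivot_def
      using v x y vw
      by (cases "x = v"; cases "x = w"; cases "y = v"; cases "y = w")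
         (auto simp: edge_local_complement neighbors_def c)
  qed
qed

text \<open>These are the row operations that turn the simple columns of \<open>v\<close> and
  \<open>w\<close> into unit columns. The simple column of \<open>v\<close> has 0 in row
  \<open>v\<close> and 1 in row \<open>w\<close>, hence the exchange of the two rows; the added
  multiples clear all other entries. The three columns of a cell sum to zero, so the third one
  follows by linearity.\<close>

lemma IAS_pivot:
  fixes e :: "'a \<times> label"
  assumes v: "v \<in> verts G" and w: "w \<in> neighbors G v" and r: "r \<in> verts G"
    and e: "e \<in> verts G \<times> UNIV"
  shows "IAS (edge_pivot G v w) r (pivot_map G v w e) =
    (if r = v then IAS G w e else if r = w then IAS G v e
     else IAS G r e + adjacency_matrix G r v * IAS G w e + adjacency_matrix G r w * IAS G v e)"
proof -
  obtain u i where ui: "e = (u, i)" by (cases e)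
  have u: "u \<in> verts G" using e ui by simp
  have vw: "v \<noteq> w" "w \<noteq> v" "{v, w} \<in> edges G" "{w, v} \<in> edges G" "w \<in> verts G"
    using w by (auto simp: neighbors_def insert_commute)
  have c: "{r, v} = {v, r}" "{r, w} = {w, r}" "{u, v} = {v, u}" "{u, w} = {w, u}"
    by auto
  note edge = edge_edge_pivot[OF v w]
  have loop: "{x} \<in> edges (edge_pivot G v w) \<longleftrightarrow> {x} \<in> edges G" for x
    using looped_edge_pivot[of G v w x] by (simp add: looped_def)
  show ?thesis
    unfolding ui using vw v r u
    by (cases i; cases "u = v"; cases "u = w"; cases "r = v"; cases "r = w"; cases "r = u")
       (auto simp: pivot_map_def adjacency_matrix_def edge loop loop_swap_def looped_def c)
qed

lemma matroid_iso_pivot_map: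
  assumes v: "v \<in> verts G" and w: "w \<in> neighbors G v"
  shows "matroid_iso (pivot_map G v w) (isotropic_matroid G) (isotropic_matroid (edge_pivot G v w))"
  unfolding isotropic_matroid_def verts_edge_pivot
proof (rule matroid_iso_column_matroidI)
  have "pivot_map G v w ` (verts G \<times> UNIV) \<subseteq> verts G \<times> UNIV"
    by (auto simp: pivot_map_def)
  then show "bij_betw (pivot_map G v w) (verts G \<times> UNIV) (verts G \<times> UNIV)"
    by (intro bij_betw_byWitness[where f' = "pivot_map G v w"])
       (simp_all add: pivot_map_involutory)
  fix c :: "'a \<times> label \<Rightarrow> bit" and S assume S: "S \<subseteq> verts G \<times> (UNIV :: label set)"
  define R where "R r = (\<Sum>e\<in>S. c e * IAS G r e)" for r
  define R' where "R' r = (\<Sum>e\<in>S. c e * IAS (edge_pivot G v w) r (pivot_map G v w e))" for r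
  have vw: "v \<noteq> w" "w \<in> verts G" using w by (auto simp: neighbors_def)
  have R': "R' r = (if r = v then R w else if r = w then R v
      else R r + adjacency_matrix G r v * R w + adjacency_matrix G r w * R v)"
    if r: "r \<in> verts G" for r
  proof -
    have "R' r = (\<Sum>e\<in>S. c e * (if r = v then IAS G w e else if r = w then IAS G v e
      else IAS G r e + adjacency_matrix G r v * IAS G w e + adjacency_matrix G r w * IAS G v e))"
      unfolding R'_def using S by (intro sum.cong refl) (subst IAS_pivot[OF v w r], auto)
    also have "\<dots> = (if r = v then R w else if r = w then R v
      else R r + adjacency_matrix G r v * R w + adjacency_matrix G r w * R v)"
      unfolding R_def
      by (cases "r = v"; cases "r = w")
         (simp_all only: distrib_left sum.distrib sum_distrib_left mult.left_commute
            if_True if_False simp_thms)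
    finally show ?thesis .
  qed
  have "(\<forall>r\<in>verts G. R r = 0) \<longleftrightarrow> (\<forall>r\<in>verts G. R' r = 0)"
  proof
    assume "\<forall>r\<in>verts G. R r = 0"
    then show "\<forall>r\<in>verts G. R' r = 0" using v vw by (simp add: R')
  next
    assume *: "\<forall>r\<in>verts G. R' r = 0"
    \<comment> \<open>The rows \<open>v\<close> and \<open>w\<close> of the pivot are the rows
      \<open>w\<close> and \<open>v\<close> of \<open>G\<close>. Once both sums vanish, the
      correction terms in all other rows disappear.\<close>
    then have "R v = 0" "R w = 0" using R'[OF v] R'[OF vw(2)] v vw by auto
    then show "\<forall>r\<in>verts G. R r = 0" using * R' by (metis add.right_neutral mult_zero_right)
  qed
  then show "(\<forall>r\<in>verts G. (\<Sum>e\<in>S. c e * IAS G r e) = 0) \<longleftrightarrow>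
    (\<forall>r\<in>verts G. (\<Sum>e\<in>S. c e * IAS (edge_pivot G v w) r (pivot_map G v w e)) = 0)"
    by (simp add: R_def R'_def)
qed

lemma pivot_map_image_cell: "pivot_map G v w ` cell u = cell u"
proof
  show sub: "pivot_map G v w ` cell u \<subseteq> cell u" by (auto simp: cell_altdef pivot_map_def)
  show "cell u \<subseteq> pivot_map G v w ` cell u"
    using image_mono[OF sub, of "pivot_map G v w"] by (simp add: image_image pivot_map_involutory)
qed

text \<open>Since \<open>pivot_map\<close> is its own inverse, the same map also leads back from the
  pivot to \<open>G\<close>.\<close>

lemma compatible_iso_pivot_map:
  assumes "v \<in> verts G" "w \<in> neighbors G v"
  shows "compatible_iso (pivot_map G v w) G (edge_pivot G v w)"
    and "compatible_iso (pivot_map G v w) (edge_pivot G v w) G"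
  using matroid_iso_pivot_map[OF assms]
    matroid_iso_involution[OF matroid_iso_pivot_map[OF assms] pivot_map_involutory]
  by (auto simp: compatible_iso_def pivot_map_image_cell)

lemma label_map_comp_pivot_map:
  "label_map (f \<circ> pivot_map G v w) u =
    (if u = v \<or> u = w then label_map f u \<circ> loop_swap G u else label_map f u)"
  by (auto simp: label_map_def pivot_map_def fun_eq_iff)

text \<open>The permitted label maps at \<open>u\<close> form a group of order two, and a pivot at
  most multiplies by its generator.\<close>

lemma label_map_comp_pivot_map_mem:
  assumes "label_map f u \<in> {id, loop_swap G u}"
  shows "label_map (f \<circ> pivot_map G v w) u \<in> {id, loop_swap G u}"
  using assms by (auto simp: label_map_comp_pivot_map fun_eq_iff loop_swap_involutory)

text \<open>The first part builds an isomorphism along a sequence of pivots; the second replaces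
  \<open>G\<close> by a pivot with fewer swapped vertices.\<close>

lemma simple_iso_comp_pivot_map:
  assumes "v \<in> verts G" "w \<in> neighbors G v"
  shows "simple_iso f (edge_pivot G v w) H \<Longrightarrow> simple_iso (f \<circ> pivot_map G v w) G H"
    and "simple_iso f G H \<Longrightarrow> simple_iso (f \<circ> pivot_map G v w) (edge_pivot G v w) H"
  using compatible_iso_pivot_map[OF assms] label_map_comp_pivot_map_mem[of f _ G v w]
  by (auto simp: simple_iso_def intro: compatible_iso_comp simp del: insert_iff)

section \<open>Graph isomorphisms and trivial label maps\<close>

lemma simple_iso_of_graph_iso:
  assumes "graph_iso h G H"
  shows "simple_iso (map_prod h id) G H"
proof -
  have bij: "bij_betw h (verts G) (verts H)"
    and edge: "\<And>x y. x \<in> verts G \<Longrightarrow> y \<in> verts G \<Longrightarrow> {h x, h y} \<in> edges H \<longleftrightarrow> {x, y} \<in> edges G"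
    using assms by (auto simp: graph_iso_def)
  have IAS: "IAS H (h r) (map_prod h id e) = IAS G r e"
    if "r \<in> verts G" "e \<in> verts G \<times> UNIV" for r e
  proof -
    obtain v i where e: "e = (v, i)" by (cases e)
    have "h r = h v \<longleftrightarrow> r = v" using bij that e by (auto simp: bij_betw_def inj_on_def)
    then show ?thesis using that e by (cases i) (auto simp: adjacency_matrix_def edge)
  qed
  have "matroid_iso (map_prod h id) (isotropic_matroid G) (isotropic_matroid H)"
    unfolding isotropic_matroid_def
  proof (rule matroid_iso_column_matroidI)
    show "bij_betw (map_prod h id) (verts G \<times> (UNIV :: label set)) (verts H \<times> UNIV)"
      using bij bij_betw_id by (rule bij_betw_map_prod)
    fix c :: "'a \<times> label \<Rightarrow> bit" and S assume S: "S \<subseteq> verts G \<times> (UNIV :: label set)"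
    have "(\<Sum>e\<in>S. c e * IAS H (h r) (map_prod h id e)) = (\<Sum>e\<in>S. c e * IAS G r e)"
      if "r \<in> verts G" for r
      using S by (intro sum.cong refl) (subst IAS[OF that], auto)
    moreover have "verts H = h ` verts G" using bij by (simp add: bij_betw_def)
    ultimately show "(\<forall>r\<in>verts G. (\<Sum>e\<in>S. c e * IAS G r e) = 0) \<longleftrightarrow>
      (\<forall>r\<in>verts H. (\<Sum>e\<in>S. c e * IAS H r (map_prod h id e)) = 0)"
      by simp
  qed
  moreover have "\<exists>w\<in>verts H. map_prod h id ` cell v = cell w" if "v \<in> verts G" for v
    using bij that by (intro bexI[of _ "h v"]) (auto simp: cell_def bij_betw_def)
  moreover have "label_map (map_prod h id) v = id" for v
    by (auto simp: label_map_def)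
  ultimately show ?thesis by (simp add: simple_iso_def compatible_iso_def)
qed

text \<open>Exchange in the standard basis: the \<open>Chi\<close>-column of \<open>v\<close> can
  replace the \<open>Phi\<close>-column of \<open>r\<close> iff its coordinate at \<open>r\<close>
  is nonzero. Thus the labeled matroid determines the graph, the case \<open>r = v\<close> detecting
  loops.\<close>

lemma indep_exchange_iff:
  assumes fin: "finite (verts G)" and r: "r \<in> verts G" and v: "v \<in> verts G"
  shows "indep (isotropic_matroid G) (insert (v, Chi) ((verts G - {r}) \<times> {Phi})) \<longleftrightarrow>
    {r, v} \<in> edges G"
proof -
  let ?B = "(verts G - {r}) \<times> {Phi}"
  have sum: "(\<Sum>e\<in>insert (v, Chi) ?B. c e * IAS G s e) =
      c (v, Chi) * adjacency_matrix G s v + (if s \<noteq> r then c (s, Phi) else 0)"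
    if "s \<in> verts G" for s c
  proof -
    have "(\<Sum>e\<in>?B. c e * IAS G s e) = (\<Sum>u\<in>verts G - {r}. if s = u then c (u, Phi) else 0)"
      by (rule sum.reindex_cong[of "\<lambda>u. (u, Phi)"]) (auto simp: inj_on_def)
    also have "\<dots> = (if s \<noteq> r then c (s, Phi) else 0)"
      using fin that by (simp add: sum.delta)
    finally have "(\<Sum>e\<in>?B. c e * IAS G s e) = (if s \<noteq> r then c (s, Phi) else 0)" .
    moreover have "finite ?B" "(v, Chi) \<notin> ?B" using fin by auto
    ultimately show ?thesis by (simp only: sum.insert IAS.simps not_False_eq_True)
  qed
  have sub: "insert (v, Chi) ?B \<subseteq> verts G \<times> UNIV" using v by auto
  have ind: "indep (isotropic_matroid G) (insert (v, Chi) ?B) \<longleftrightarrow>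
    (\<forall>c. (\<forall>s\<in>verts G. c (v, Chi) * adjacency_matrix G s v + (if s \<noteq> r then c (s, Phi) else 0) = 0)
      \<longrightarrow> (\<forall>e\<in>insert (v, Chi) ?B. c e = 0))"
    using sub unfolding isotropic_matroid_def column_matroid_def
    by (simp only: matroid.select_convs sum simp_thms cong: ball_cong)
  show ?thesis
  proof
    assume I: "indep (isotropic_matroid G) (insert (v, Chi) ?B)"
    show "{r, v} \<in> edges G"
    proof (rule ccontr)
      assume "{r, v} \<notin> edges G"
      \<comment> \<open>With a zero in row \<open>r\<close>, the \<open>Chi\<close>-column of
        \<open>v\<close> is the sum of the remaining unit columns weighted by its own
        entries.\<close>
      define c where "c = (\<lambda>(u, i). if i = Chi then 1 else adjacency_matrix G u v)"
      have "\<forall>s\<in>verts G. c (v, Chi) * adjacency_matrix G s v + (if s \<noteq> r then c (s, Phi) else 0) = 0"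
        using \<open>{r, v} \<notin> edges G\<close> by (auto simp: c_def adjacency_matrix_def)
      then have "c (v, Chi) = 0" using I unfolding ind by blast
      then show False by (simp add: c_def)
    qed
  next
    assume A: "{r, v} \<in> edges G"
    show "indep (isotropic_matroid G) (insert (v, Chi) ?B)"
      unfolding ind
    proof (intro allI impI)
      fix c assume c: "\<forall>s\<in>verts G. c (v, Chi) * adjacency_matrix G s v
        + (if s \<noteq> r then c (s, Phi) else 0) = 0"
      \<comment> \<open>Row \<open>r\<close> contains only the \<open>Chi\<close>-term, the unit
        column of \<open>r\<close> having been removed.\<close>
      have "c (v, Chi) = 0" using c r A by (auto simp: adjacency_matrix_def)
      then show "\<forall>e\<in>insert (v, Chi) ?B. c e = 0" using c by (auto split: if_splits)
    qed
  qed
qed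

text \<open>With trivial label maps, \<open>f\<close> carries the exchanged basis for
  \<open>r\<close>, \<open>v\<close> to the one for their images, so edges and loops agree by
  \<open>indep_exchange_iff\<close>.\<close>

lemma graph_iso_vertex_map:
  assumes f: "compatible_iso f G H" and id: "\<And>v. v \<in> verts G \<Longrightarrow> label_map f v = id"
    and fin: "finite (verts G)"
  shows "graph_iso (vertex_map f) G H"
proof -
  let ?h = "vertex_map f"
  have bij: "bij_betw ?h (verts G) (verts H)" using f by (rule bij_betw_vertex_map)
  have finH: "finite (verts H)" using bij fin bij_betw_finite by blast
  have app: "f (v, i) = (?h v, i)" if "v \<in> verts G" for v i
    using compatible_iso_apply[OF f that] id[OF that] by simp
  have "{r, v} \<in> edges G \<longleftrightarrow> {?h r, ?h v} \<in> edges H" if r: "r \<in> verts G" and v: "v \<in> verts G" for r v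
  proof -
    let ?B = "insert (v, Chi) ((verts G - {r}) \<times> {Phi})"
    have "f ` ((verts G - {r}) \<times> {Phi}) = (?h ` (verts G - {r})) \<times> {Phi}"
      by (force simp: app image_iff)
    also have "?h ` (verts G - {r}) = verts H - {?h r}"
      using bij r by (auto simp: bij_betw_def inj_on_def)
    finally have img: "f ` ?B = insert (?h v, Chi) ((verts H - {?h r}) \<times> {Phi})"
      by (simp add: app v)
    have "?B \<subseteq> ground (isotropic_matroid G)" using v by (auto simp: isotropic_matroid_def)
    then have "indep (isotropic_matroid G) ?B \<longleftrightarrow> indep (isotropic_matroid H) (f ` ?B)"
      using f by (simp add: compatible_iso_def matroid_iso_def)
    moreover have "?h r \<in> verts H" "?h v \<in> verts H" using bij r v by (auto simp: bij_betw_def)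
    ultimately show ?thesis
      unfolding img using indep_exchange_iff[OF fin r v] indep_exchange_iff[OF finH] by simp
  qed
  then show ?thesis using bij by (simp add: graph_iso_def)
qed

section \<open>Dependence among simple columns\<close>

lemma indep_Phi:
  assumes fin: "finite (verts G)" and S: "S \<subseteq> verts G \<times> {Phi}"
  shows "indep (isotropic_matroid G) S"
proof -
  have "c e = 0" if c: "\<forall>r\<in>verts G. (\<Sum>e\<in>S. c e * IAS G r e) = 0" and e: "e \<in> S" for c e
  proof -
    obtain v where v: "e = (v, Phi)" "v \<in> verts G" using S e by auto
    have "finite S" using S fin by (auto intro: finite_subset)
    then have "(\<Sum>d\<in>S. c d * IAS G v d) = (\<Sum>d\<in>S. if d = e then c d else 0)"
      using S v by (intro sum.cong) auto
    then show ?thesis using c v e \<open>finite S\<close> by (simp add: sum.delta)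
  qed
  then show ?thesis using S by (auto simp: isotropic_matroid_def column_matroid_def)
qed

text \<open>The simple column of \<open>v\<close> is the characteristic vector of the open
  neighborhood, hence the sum of the \<open>Phi\<close>-columns of the neighbors.\<close>

lemma simple_column_dependent:
  assumes fin: "finite (verts G)" and v: "v \<in> verts G"
  shows "\<not> indep (isotropic_matroid G) (insert (v, loop_swap G v Phi) (neighbors G v \<times> {Phi}))"
proof
  let ?x = "(v, loop_swap G v Phi)" and ?N = "neighbors G v \<times> {Phi}"
  assume "indep (isotropic_matroid G) (insert ?x ?N)"
  \<comment> \<open>The factor 1 displays the constant coefficient family that contradicts
    independence.\<close>
  moreover have "(\<Sum>e\<in>insert ?x ?N. 1 * IAS G r e) = 0" if r: "r \<in> verts G" for r
  proof -
    have finN: "finite (neighbors G v)" using fin by (simp add: neighbors_def)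
    have "(\<Sum>e\<in>?N. IAS G r e) = (\<Sum>u\<in>neighbors G v. of_bool (r = u))"
      by (rule sum.reindex_cong[of "\<lambda>u. (u, Phi)"]) (auto simp: inj_on_def)
    also have "\<dots> = of_bool (r \<in> neighbors G v)"
      using finN by (simp add: of_bool_def sum.delta)
    also have "\<dots> = IAS G r ?x"
      using r by (auto simp: loop_swap_def looped_def neighbors_def adjacency_matrix_def insert_commute)
    moreover have "?x \<notin> ?N" by (auto simp: neighbors_def)
    ultimately have "(\<Sum>e\<in>insert ?x ?N. IAS G r e) = IAS G r ?x + IAS G r ?x"
      using finN by (subst sum.insert) auto
    also have "\<dots> = 0" by simp
    finally show ?thesis by (simp only: mult_1)
  qed
  ultimately show False
    unfolding isotropic_matroid_def column_matroid_def
    by (auto dest: spec[where x = "\<lambda>_. 1"])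
qed

text \<open>Otherwise \<open>f\<close> sends the dependent set of
  \<open>simple_column_dependent\<close> into the \<open>Phi\<close>-columns of \<open>H\<close>:
  the swap at \<open>v\<close> moves its simple column there, and the neighbors keep their
  labels.\<close>

lemma swapped_vertex_has_swapped_neighbor:
  assumes f: "simple_iso f G H" and fin: "finite (verts G)"
    and v: "v \<in> verts G" "label_map f v \<noteq> id"
  shows "\<exists>w\<in>neighbors G v. label_map f w \<noteq> id"
proof (rule ccontr)
  assume *: "\<not> ?thesis"
  let ?C = "insert (v, loop_swap G v Phi) (neighbors G v \<times> {Phi})"
  have comp: "compatible_iso f G H" using f by (simp add: simple_iso_def)
  have bij: "bij_betw (vertex_map f) (verts G) (verts H)" using comp by (rule bij_betw_vertex_map)
  have "label_map f v = loop_swap G v" using f v by (auto simp: simple_iso_def)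
  then have "f (v, loop_swap G v Phi) = (vertex_map f v, Phi)"
    using compatible_iso_apply[OF comp v(1)] by (simp add: loop_swap_involutory)
  moreover have "f (u, Phi) = (vertex_map f u, Phi)" if "u \<in> neighbors G v" for u
    using compatible_iso_apply[OF comp] that * by (auto simp: neighbors_def)
  ultimately have "f ` ?C \<subseteq> verts H \<times> {Phi}"
    using bij v(1) by (auto simp: bij_betw_def neighbors_def)
  moreover have "finite (verts H)" using bij fin bij_betw_finite by blast
  ultimately have "indep (isotropic_matroid H) (f ` ?C)" by (intro indep_Phi)
  moreover have "?C \<subseteq> ground (isotropic_matroid G)"
    using v(1) by (auto simp: isotropic_matroid_def neighbors_def)
  ultimately have "indep (isotropic_matroid G) ?C"
    using comp by (simp add: compatible_iso_def matroid_iso_def)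
  then show False using simple_column_dependent[OF fin v(1)] by simp
qed

section \<open>The two implications\<close>

lemma pivots_if_simple_iso:
  assumes "simple_iso f G H" "finite (verts G)"
  shows "\<exists>K. pivot_step\<^sup>*\<^sup>* G K \<and> graph_isomorphic K H"
  using assms
proof (induction "card {v \<in> verts G. label_map f v \<noteq> id}" arbitrary: G f rule: less_induct)
  case less
  show ?case
  proof (cases "\<exists>v\<in>verts G. label_map f v \<noteq> id")
    case False
    then have "graph_iso (vertex_map f) G H"
      using less.prems by (intro graph_iso_vertex_map) (auto simp: simple_iso_def)
    then show ?thesis by (auto simp: graph_isomorphic_def)
  next
    case True
    then obtain v where v: "v \<in> verts G" "label_map f v \<noteq> id" by blast
    then obtain w where w: "w \<in> neighbors G v" "label_map f w \<noteq> id"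
      using swapped_vertex_has_swapped_neighbor less.prems by metis
    have wG: "w \<in> verts G" using w(1) by (simp add: neighbors_def)
    let ?G = "edge_pivot G v w" and ?f = "f \<circ> pivot_map G v w"
    have "label_map f v = loop_swap G v" "label_map f w = loop_swap G w"
      using less.prems(1) v w(2) wG by (auto simp: simple_iso_def)
    \<comment> \<open>At \<open>v\<close> and \<open>w\<close> the swap of the pivot cancels the
      swap of \<open>f\<close>; no other label map changes.\<close>
    then have "label_map ?f u = (if u = v \<or> u = w then id else label_map f u)" for u
      by (auto simp: label_map_comp_pivot_map fun_eq_iff loop_swap_involutory)
    then have "{u \<in> verts ?G. label_map ?f u \<noteq> id} \<subset> {u \<in> verts G. label_map f u \<noteq> id}"
      using v by auto
    then have "card {u \<in> verts ?G. label_map ?f u \<noteq> id} < card {u \<in> verts G. label_map f u \<noteq> id}"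
      using less.prems(2) by (intro psubset_card_mono) auto
    moreover have "simple_iso ?f ?G H"
      using less.prems(1) v(1) w(1) by (intro simple_iso_comp_pivot_map)
    ultimately obtain K where "pivot_step\<^sup>*\<^sup>* ?G K" "graph_isomorphic K H"
      using less.hyps[of ?G ?f] less.prems(2) by auto
    moreover have "pivot_step G ?G" using v(1) w(1) by (auto simp: pivot_step_def)
    ultimately show ?thesis by (meson converse_rtranclp_into_rtranclp)
  qed
qed

lemma simple_iso_if_pivots:
  assumes "pivot_step\<^sup>*\<^sup>* G K" "graph_isomorphic K H"
  shows "\<exists>f. simple_iso f G H"
  using assms
\<comment> \<open>Peeling off the first pivot keeps \<open>H\<close> fixed, so each pivot map is
  composed on the side of \<open>G\<close>.\<close>
proof (induction rule: converse_rtranclp_induct)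
  case base
  then show ?case using simple_iso_of_graph_iso by (auto simp: graph_isomorphic_def)
next
  case (step G G')
  then obtain f where f: "simple_iso f G' H" by blast
  obtain v w where vw: "v \<in> verts G" "w \<in> neighbors G v" and G': "G' = edge_pivot G v w"
    using step.hyps(1) by (auto simp: pivot_step_def)
  show ?case using simple_iso_comp_pivot_map(1)[OF vw] f unfolding G' by blast
qed

theorem theorem14:
  fixes G1 :: "'a lgraph" and G2 :: "'b lgraph"
  assumes "looped_simple_graph G1" and "looped_simple_graph G2"
  shows "(\<exists>H. pivot_step\<^sup>*\<^sup>* G1 H \<and> graph_isomorphic H G2) \<longleftrightarrow>
    (\<exists>\<beta>. compatible_iso \<beta> G1 G2 \<and>
      (\<forall>v \<in> verts G1. looped G1 v \<longrightarrow> label_map \<beta> v \<in> {id, transpose Phi Psi}) \<and>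
      (\<forall>v \<in> verts G1. \<not> looped G1 v \<longrightarrow> label_map \<beta> v \<in> {id, transpose Phi Chi}))"
proof -
  have "simple_iso \<beta> G1 G2 \<longleftrightarrow> compatible_iso \<beta> G1 G2 \<and>
      (\<forall>v \<in> verts G1. looped G1 v \<longrightarrow> label_map \<beta> v \<in> {id, transpose Phi Psi}) \<and>
      (\<forall>v \<in> verts G1. \<not> looped G1 v \<longrightarrow> label_map \<beta> v \<in> {id, transpose Phi Chi})" for \<beta>
    by (auto simp: simple_iso_def loop_swap_def)
  moreover have "finite (verts G1)" using assms(1) by (simp add: looped_simple_graph_def)
  ultimately show ?thesis using pivots_if_simple_iso simple_iso_if_pivots by blast
qed

end
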